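(* Let $X$ be a real Hilbert space, let $m\in\{2,3,\dots\}$, let $A_1,\dots,A_m: X\rightrightarrows X$ be maximally monotone operators with resolvents $J_i=(\mathrm{Id}+A_i)^{-1}$, and let $F_1,\dots,F_m$ be the fixed point sets of the cyclic compositions of the resolvents. Then the following are equivalent: (1) a cycle exists; (2) $F_i\neq\varnothing$ for all $1\le i\le m$.
   Context: For $i\in\{1,\dots,m\}$, $F_i:=\operatorname{Fix}(J_iJ_{i-1}\cdots J_1J_m\cdots J_{i+1})=\{z\in X\mid z=J_iJ_{i-1}\cdots J_1J_m\cdots J_{i+1}z\}$; thus $F_1=\operatorname{Fix}(J_1J_m\cdots J_2)$, $F_2=\operatorname{Fix}(J_2J_1J_m\cdots J_3)$, ..., $F_m=\operatorname{Fix}(J_mJ_{m-1}\cdots J_1)$. Here $\operatorname{Fix}S=\{x\mid x=Sx\}$. A tuple $\mathbf z=(z_1,\dots,z_m)\in X^m$ is called a cycle if $z_1\in F_1$, $z_2=J_2z_1$, $z_3=J_3z_2$, ..., $z_m=J_mz_{m-1}$. *)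

theory Defs
  imports "HOL-Analysis.Analysis"
begin

definition monotone_op :: "('a::real_inner \<Rightarrow> 'a set) \<Rightarrow> bool" where
  "monotone_op A \<longleftrightarrow> (\<forall>x y. \<forall>u\<in>A x. \<forall>v\<in>A y. 0 \<le> (x - y) \<bullet> (u - v))"

definition maximally_monotone :: "('a::real_inner \<Rightarrow> 'a set) \<Rightarrow> bool" where
  "maximally_monotone A \<longleftrightarrow>
     monotone_op A \<and> (\<forall>B. monotone_op B \<longrightarrow> (\<forall>x. A x \<subseteq> B x) \<longrightarrow> B = A)"

definition op_id :: "'a \<Rightarrow> 'a set" where
  "op_id x = {x}"

definition op_sum :: "('a::plus \<Rightarrow> 'a set) \<Rightarrow> ('a \<Rightarrow> 'a set) \<Rightarrow> 'a \<Rightarrow> 'a set" where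
  "op_sum A B x = {u + v | u v. u \<in> A x \<and> v \<in> B x}"

definition op_inverse :: "('a \<Rightarrow> 'b set) \<Rightarrow> 'b \<Rightarrow> 'a set" where
  "op_inverse A y = {x. y \<in> A x}"

(* For a maximally monotone operator on a Hilbert space the set below is a singleton for
   every x: uniqueness is resolvent_eqI below, existence is Minty's theorem. The definite
   description therefore turns the set-valued operator (Id + A)^(-1) into the usual
   single-valued, everywhere defined resolvent. *)
definition resolvent :: "('a::real_inner \<Rightarrow> 'a set) \<Rightarrow> 'a \<Rightarrow> 'a" where
  "resolvent A x = (THE y. y \<in> op_inverse (op_sum op_id A) x)"

lemma resolvent_eqI:
  assumes "monotone_op A" and y: "y \<in> op_inverse (op_sum op_id A) x"
  shows "resolvent A x = y"
  unfolding resolvent_def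
proof (rule the_equality)
  show "y \<in> op_inverse (op_sum op_id A) x" by (rule y)
next
  fix z assume z: "z \<in> op_inverse (op_sum op_id A) x"
  have *: "x - w \<in> A w" if "w \<in> op_inverse (op_sum op_id A) x" for w
    using that by (auto simp: op_inverse_def op_sum_def op_id_def)
  have "x - z \<in> A z" "x - y \<in> A y"
    using *[OF z] *[OF y] .
  with assms(1) have "0 \<le> (z - y) \<bullet> ((x - z) - (x - y))"
    unfolding monotone_op_def by blast
  moreover have "(x - z) - (x - y) = - (z - y)" by simp
  ultimately have "(z - y) \<bullet> (z - y) \<le> 0" by (simp only: inner_minus_right)
  then show "z = y" by (metis inner_gt_zero_iff not_le right_minus_eq)
qed

definition Fix :: "('a \<Rightarrow> 'a) \<Rightarrow> 'a set" where
  "Fix S = {x. x = S x}"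

(* The composition J_i J_(i-1) ... J_1 J_m ... J_(i+1); the list gives its factors from
   left to right, so that J_(i+1) (or J_1 if i = m) is applied first. *)
definition cyclic_comp :: "nat \<Rightarrow> (nat \<Rightarrow> 'a \<Rightarrow> 'a) \<Rightarrow> nat \<Rightarrow> 'a \<Rightarrow> 'a" where
  "cyclic_comp m J i = foldr (\<circ>) (map J (rev [1..<i+1] @ rev [i+1..<m+1])) id"

definition cyclic_fix :: "nat \<Rightarrow> (nat \<Rightarrow> 'a \<Rightarrow> 'a) \<Rightarrow> nat \<Rightarrow> 'a set" where
  "cyclic_fix m J i = Fix (cyclic_comp m J i)"

(* A tuple in X^m is an extensional function on {1..m}. *)
definition is_cycle :: "nat \<Rightarrow> (nat \<Rightarrow> 'a \<Rightarrow> 'a) \<Rightarrow> (nat \<Rightarrow> 'a) \<Rightarrow> bool" where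
  "is_cycle m J z \<longleftrightarrow>
     z \<in> {1..m} \<rightarrow>\<^sub>E UNIV \<and> z 1 \<in> cyclic_fix m J 1 \<and> (\<forall>i\<in>{2..m}. z i = J i (z (i - 1)))"

end

theory Submission
  imports Defs
begin

text \<open>
  The cyclic compositions are shifts of one another: applying \<open>J (Suc i)\<close> after the composition
  with index \<open>i\<close> is the same as applying it before the composition with index \<open>Suc i\<close>. Hence
  \<open>J (Suc i)\<close> carries fixed points from each index to the next, and a single fixed point for the
  index \<open>1\<close> spreads to all other indices. Both implications follow, since a cycle is a fixed point
  for the index \<open>1\<close> together with its images under this transport.
\<close>

lemma foldr_comp_eq_comp: "foldr (\<circ>) fs g = foldr (\<circ>) fs id \<circ> g"
  by (induction fs) (simp_all add: comp_assoc)

text \<open>Moving the index from \<open>i\<close> to \<open>Suc i\<close> takes the rightmost factor \<open>J (Suc i)\<close> away and puts it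
  back on the left, so both sides below are the same word in the factors, of length \<open>m + 1\<close>.\<close>

lemma cyclic_comp_shift:
  assumes "i < m"
  shows "J (Suc i) (cyclic_comp m J i x) = cyclic_comp m J (Suc i) (J (Suc i) x)"
proof -
  define P where "P = map J (rev [1..<i+1])"
  define Q where "Q = map J (rev [Suc i+1..<m+1])"
  have split: "[i+1..<m+1] = Suc i # [Suc i+1..<m+1]"
    using assms by (simp add: upt_conv_Cons del: upt_Suc)
  have "cyclic_comp m J i = foldr (\<circ>) (P @ Q @ [J (Suc i)]) id"
    unfolding cyclic_comp_def P_def Q_def split by simp
  also have "\<dots> = foldr (\<circ>) (P @ Q) id \<circ> J (Suc i)"
    using foldr_comp_eq_comp[of "P @ Q" "J (Suc i)"] by simp
  finally have "J (Suc i) \<circ> cyclic_comp m J i = foldr (\<circ>) (J (Suc i) # P @ Q) id \<circ> J (Suc i)"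
    by (simp add: comp_assoc)
  moreover have "cyclic_comp m J (Suc i) = foldr (\<circ>) (J (Suc i) # P @ Q) id"
    unfolding cyclic_comp_def P_def Q_def by simp
  ultimately show ?thesis
    by (simp add: fun_eq_iff)
qed

lemma cyclic_fix_step:
  assumes "i < m" and "x \<in> cyclic_fix m J i"
  shows "J (Suc i) x \<in> cyclic_fix m J (Suc i)"
  using assms(2) cyclic_comp_shift[OF assms(1), of J x]
  by (simp add: cyclic_fix_def Fix_def)

lemma cycle_component_in_cyclic_fix:
  assumes "is_cycle m J z" and "1 \<le> i" and "i \<le> m"
  shows "z i \<in> cyclic_fix m J i"
  using assms(2,3)
proof (induction i rule: dec_induct)
  case base
  show ?case using assms(1) by (simp add: is_cycle_def)
next
  case (step i)
  have "z (Suc i) = J (Suc i) (z i)"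
    using assms(1) step by (simp add: is_cycle_def)
  with step show ?case by (simp add: cyclic_fix_step)
qed

lemma cycle_from_cyclic_fix:
  assumes "1 \<le> m" and "x \<in> cyclic_fix m J 1"
  shows "\<exists>z. is_cycle m J z"
proof -
  \<comment> \<open>Starting the recursion at the index \<open>0\<close> with the value \<open>x\<close> but letting the step that leads to
      the index \<open>1\<close> return its argument places \<open>x\<close> at the first position of the tuple.\<close>
  define w where "w = rec_nat x (\<lambda>k y. if k = 0 then y else J (Suc k) y)"
  let ?z = "restrict w {1..m}"
  have "?z 1 \<in> cyclic_fix m J 1"
    using assms by (simp add: w_def)
  moreover have "?z i = J i (?z (i - 1))" if "i \<in> {2..m}" for i
    using that by (cases i) (simp_all add: w_def)
  moreover have "?z \<in> {1..m} \<rightarrow>\<^sub>E UNIV"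
    by (rule restrict_PiE_iff[THEN iffD2]) simp
  ultimately have "is_cycle m J ?z"
    unfolding is_cycle_def by (intro conjI ballI)
  then show ?thesis by (intro exI)
qed

theorem theorem4p1:
  fixes A :: "nat \<Rightarrow> 'a::{real_inner, complete_space} \<Rightarrow> 'a set"
    and J :: "nat \<Rightarrow> 'a \<Rightarrow> 'a"
    and m :: nat
  assumes "m \<ge> 2"
    and "\<And>i. i \<in> {1..m} \<Longrightarrow> maximally_monotone (A i)"
    and "\<And>i. i \<in> {1..m} \<Longrightarrow> J i = resolvent (A i)"
  shows "(\<exists>z. is_cycle m J z) \<longleftrightarrow> (\<forall>i\<in>{1..m}. cyclic_fix m J i \<noteq> {})"
proof
  assume "\<exists>z. is_cycle m J z"
  then obtain z where z: "is_cycle m J z" ..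
  show "\<forall>i\<in>{1..m}. cyclic_fix m J i \<noteq> {}"
  proof
    fix i assume "i \<in> {1..m}"
    then have "z i \<in> cyclic_fix m J i"
      using cycle_component_in_cyclic_fix[OF z] by simp
    then show "cyclic_fix m J i \<noteq> {}" by blast
  qed
next
  assume "\<forall>i\<in>{1..m}. cyclic_fix m J i \<noteq> {}"
  moreover have "1 \<in> {1..m}" using assms(1) by simp
  ultimately obtain x where "x \<in> cyclic_fix m J 1" by blast
  moreover have "1 \<le> m" using assms(1) by simp
  ultimately show "\<exists>z. is_cycle m J z"
    by (intro cycle_from_cyclic_fix)
qed

end
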